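(* Let $p=(12,R)$ be the mesh pattern with $R=\{(0,0),(0,1),(0,2),(1,0),(1,2),(2,0),(2,1),(2,2)\}$. For every $n\ge 2$, there are exactly $(n-2)!$ permutations in $S_n$ containing exactly one occurrence of $p$, and exactly $n!-(n-2)!$ permutations in $S_n$ avoiding $p$ (having no occurrence of $p$).
   Context: $S_n$ is the set of permutations $\pi=\pi_1\cdots\pi_n$ of $\{1,\dots,n\}$. A mesh pattern $(12,R)$ consists of the permutation $12$ and a set $R\subseteq\{0,1,2\}\times\{0,1,2\}$ of shaded boxes. An occurrence of $(12,R)$ in $\pi\in S_n$ is a pair of positions $s<t$ with $\pi_s<\pi_t$ such that, putting $s_0=0,\ s_1=s,\ s_2=t,\ s_3=n+1$ and $v_0=0,\ v_1=\pi_s,\ v_2=\pi_t,\ v_3=n+1$, for every $(i,j)\in R$ there is no position $m$ with $s_i<m<s_{i+1}$ and $v_j<\pi_m<v_{j+1}$. *)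

theory Defs
  imports "HOL-Combinatorics.Permutations"
begin

text \<open>
  A permutation in \<open>S\<^sub>n\<close> is a function permuting \<open>{1..n}\<close> (and hence fixing every other natural number);
  \<open>\<pi> m\<close> is the entry at position \<open>m\<close>.
\<close>

definition Sn :: "nat \<Rightarrow> (nat \<Rightarrow> nat) set" where
  "Sn n = {\<pi>. \<pi> permutes {1..n}}"

text \<open>
  Occurrences of the mesh pattern \<open>(12, R)\<close>, as pairs of positions \<open>(s, t)\<close>. The lists hold the grid
  lines \<open>s\<^sub>0, \<dots>, s\<^sub>3\<close> and \<open>v\<^sub>0, \<dots>, v\<^sub>3\<close>. The set \<open>R\<close> is meant to satisfy
  \<open>R \<subseteq> {0,1,2} \<times> {0,1,2}\<close>, so that all list indices are in range.
\<close>

definition mesh12_occurrences ::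
    "(nat \<times> nat) set \<Rightarrow> nat \<Rightarrow> (nat \<Rightarrow> nat) \<Rightarrow> (nat \<times> nat) set" where
  "mesh12_occurrences R n \<pi> =
     {(s, t). s \<in> {1..n} \<and> t \<in> {1..n} \<and> s < t \<and> \<pi> s < \<pi> t \<and>
        (let sl = [0, s, t, n + 1]; vl = [0, \<pi> s, \<pi> t, n + 1] in
           \<forall>(i, j) \<in> R. \<not> (\<exists>m \<in> {1..n}.
             sl ! i < m \<and> m < sl ! (i + 1) \<and> vl ! j < \<pi> m \<and> \<pi> m < vl ! (j + 1)))}"

definition mesh12_avoids :: "(nat \<times> nat) set \<Rightarrow> nat \<Rightarrow> (nat \<Rightarrow> nat) \<Rightarrow> bool" where
  "mesh12_avoids R n \<pi> \<longleftrightarrow> mesh12_occurrences R n \<pi> = {}"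

end

theory Submission
  imports Defs
begin

text \<open>
  Every box except the central one \<open>(1,1)\<close> is shaded. Since \<open>\<pi>\<close> is injective, an entry in a position
  other than \<open>s\<close> and \<open>t\<close> lies on no horizontal grid line, so it lies inside some box; hence an
  occurrence \<open>(s, t)\<close> forces every other entry into the central box. No entry then stands left of
  \<open>s\<close>, right of \<open>t\<close>, below \<open>\<pi> s\<close> or above \<open>\<pi> t\<close>, which says that \<open>s = 1\<close>, \<open>t = n\<close>, \<open>\<pi> 1 = 1\<close> and
  \<open>\<pi> n = n\<close>. So \<open>(1, n)\<close> is the only possible occurrence, and the permutations that have it are
  those fixing both \<open>1\<close> and \<open>n\<close>, i.e. the \<open>(n-2)!\<close> permutations of \<open>{2..n-1}\<close>
  (\<open>mesh12_occurrences_frame\<close>); all the others avoid the pattern.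
\<close>

definition frame_boxes :: "(nat \<times> nat) set" where
  "frame_boxes = {(0,0), (0,1), (0,2), (1,0), (1,2), (2,0), (2,1), (2,2)}"

text \<open>
  In each of the outer columns all three boxes are shaded, so injectivity leaves no room for an entry
  there. In the middle column the shading bounds the values on both sides, again strictly because of
  injectivity.
\<close>

lemma mem_mesh12_occurrences_frame_iff:
  assumes \<pi>: "\<pi> permutes {1..n}"
  shows "(s, t) \<in> mesh12_occurrences frame_boxes n \<pi> \<longleftrightarrow>
    s \<in> {1..n} \<and> t \<in> {1..n} \<and> s < t \<and> \<pi> s < \<pi> t \<and>
    (\<forall>m\<in>{1..n} - {s, t}. s < m \<and> m < t \<and> \<pi> s < \<pi> m \<and> \<pi> m < \<pi> t)"
    (is "_ \<longleftrightarrow> ?s_in \<and> ?t_in \<and> ?lt \<and> ?vlt \<and> ?central")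
proof -
  have inj: "\<pi> x = \<pi> y \<longleftrightarrow> x = y" for x y
    using permutes_inj[OF \<pi>] by (simp add: inj_eq)
  have range: "1 \<le> \<pi> m \<and> \<pi> m \<le> n" if "m \<in> {1..n}" for m
    using permutes_in_image[OF \<pi>, of m] that by simp
  \<comment> \<open>One conjunct for each shaded box, column by column.\<close>
  let ?unshaded = "\<lambda>m.
    (m < s \<longrightarrow> \<not> \<pi> m < \<pi> s) \<and>
    (\<pi> s < \<pi> m \<longrightarrow> m < s \<longrightarrow> \<not> \<pi> m < \<pi> t) \<and>
    (\<pi> t < \<pi> m \<longrightarrow> \<not> m < s) \<and>
    (m < t \<longrightarrow> s < m \<longrightarrow> \<not> \<pi> m < \<pi> s) \<and>
    (\<pi> t < \<pi> m \<longrightarrow> m < t \<longrightarrow> \<not> s < m) \<and>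
    (t < m \<longrightarrow> \<not> \<pi> m < \<pi> s) \<and>
    (\<pi> s < \<pi> m \<longrightarrow> t < m \<longrightarrow> \<not> \<pi> m < \<pi> t) \<and>
    (\<pi> t < \<pi> m \<longrightarrow> \<not> t < m)"
  have "(s, t) \<in> mesh12_occurrences frame_boxes n \<pi> \<longleftrightarrow>
      ?s_in \<and> ?t_in \<and> ?lt \<and> ?vlt \<and> (\<forall>m\<in>{1..n}. ?unshaded m)"
  proof -
    have "0 < m" "m < Suc n" "0 < \<pi> m" "\<pi> m < Suc n" if "m \<in> {1..n}" for m
      using that range[of m] by auto
    then show ?thesis
      unfolding mesh12_occurrences_def frame_boxes_def Let_def
      by (simp add: numeral_2_eq_2 ball_conj_distrib)
  qed
  also have "\<dots> \<longleftrightarrow> ?s_in \<and> ?t_in \<and> ?lt \<and> ?vlt \<and> ?central"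
  proof (intro conj_cong refl)
    assume lt: "s < t" "\<pi> s < \<pi> t"
    have "?unshaded m \<longleftrightarrow> m = s \<or> m = t \<or> (s < m \<and> m < t \<and> \<pi> s < \<pi> m \<and> \<pi> m < \<pi> t)" for m
      using lt inj[of m s] inj[of m t] by (metis less_asym linorder_neqE_nat)
    then have "(\<forall>m\<in>{1..n}. ?unshaded m) \<longleftrightarrow>
        (\<forall>m\<in>{1..n}. m = s \<or> m = t \<or> (s < m \<and> m < t \<and> \<pi> s < \<pi> m \<and> \<pi> m < \<pi> t))"
      by (simp only:)
    also have "\<dots> \<longleftrightarrow> ?central"
      by blast
    finally show "(\<forall>m\<in>{1..n}. ?unshaded m) \<longleftrightarrow> ?central" .
  qed
  finally show ?thesis .
qed

lemma mesh12_occurrences_frame: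
  assumes \<pi>: "\<pi> permutes {1..n}" and n: "n \<ge> 2"
  shows "mesh12_occurrences frame_boxes n \<pi> = (if \<pi> permutes {2..n - 1} then {(1, n)} else {})"
proof -
  have inj: "\<pi> x = \<pi> y \<longleftrightarrow> x = y" for x y
    using permutes_inj[OF \<pi>] by (simp add: inj_eq)
  have range: "1 \<le> \<pi> m \<and> \<pi> m \<le> n" if "m \<in> {1..n}" for m
    using permutes_in_image[OF \<pi>, of m] that by simp
  have "(s, t) \<in> mesh12_occurrences frame_boxes n \<pi> \<longleftrightarrow> s = 1 \<and> t = n \<and> \<pi> 1 = 1 \<and> \<pi> n = n"
    (is "?occ \<longleftrightarrow> ?fix") for s t
  proof
    assume ?occ
    then have st: "s \<in> {1..n}" "t \<in> {1..n}" "s < t" "\<pi> s < \<pi> t"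
      and central: "\<And>m. m \<in> {1..n} \<Longrightarrow> m \<noteq> s \<Longrightarrow> m \<noteq> t \<Longrightarrow>
        s < m \<and> m < t \<and> \<pi> s < \<pi> m \<and> \<pi> m < \<pi> t"
      unfolding mem_mesh12_occurrences_frame_iff[OF \<pi>] by auto
    have pos: "s = 1" "t = n"
      using central[of 1] central[of n] st by auto
    \<comment> \<open>The positions of the least and the greatest value cannot lie in the central box.\<close>
    have surj: "\<exists>x\<in>{1..n}. \<pi> x = v" if "v \<in> {1..n}" for v
      using that permutes_image[OF \<pi>] by (metis imageE)
    obtain a where a: "a \<in> {1..n}" "\<pi> a = 1"
      using surj[of 1] n by auto
    obtain b where b: "b \<in> {1..n}" "\<pi> b = n"
      using surj[of n] n by auto
    have "a = s"
      using central[of a] a range[of s] st by fastforce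
    moreover have "b = t"
      using central[of b] b range[of t] st by fastforce
    ultimately show ?fix using pos a b by simp
  next
    assume fixed: ?fix
    have "1 < \<pi> m \<and> \<pi> m < n" if "m \<in> {1..n}" "m \<noteq> 1" "m \<noteq> n" for m
      using that range[of m] inj[of m 1] inj[of m n] fixed by linarith
    then show ?occ
      unfolding mem_mesh12_occurrences_frame_iff[OF \<pi>] using fixed n by auto
  qed
  moreover have "\<pi> permutes {2..n - 1} \<longleftrightarrow> \<pi> 1 = 1 \<and> \<pi> n = n"
  proof
    assume "\<pi> permutes {2..n - 1}"
    then show "\<pi> 1 = 1 \<and> \<pi> n = n"
      using n by (auto intro!: permutes_not_in)
  next
    assume "\<pi> 1 = 1 \<and> \<pi> n = n"
    moreover have "x = 1 \<or> x = n" if "x \<in> {1..n} - {2..n - 1}" for x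
      using that by auto
    ultimately show "\<pi> permutes {2..n - 1}"
      using permutes_superset[OF \<pi>] by blast
  qed
  ultimately show ?thesis by auto
qed

theorem theorem2p5:
  fixes n :: nat and R :: "(nat \<times> nat) set"
  assumes "R = {(0,0), (0,1), (0,2), (1,0), (1,2), (2,0), (2,1), (2,2)}"
    and "n \<ge> 2"
  shows "card {\<pi> \<in> Sn n. card (mesh12_occurrences R n \<pi>) = 1} = fact (n - 2) \<and>
         card {\<pi> \<in> Sn n. mesh12_avoids R n \<pi>} = fact n - fact (n - 2)"
proof -
  let ?Fix = "{\<pi>. \<pi> permutes {2..n - 1}}"
  have R: "R = frame_boxes"
    using assms(1) by (simp add: frame_boxes_def)
  have sub: "?Fix \<subseteq> Sn n"
    unfolding Sn_def by (auto elim!: permutes_subset)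
  have occ: "mesh12_occurrences R n \<pi> = (if \<pi> \<in> ?Fix then {(1, n)} else {})" if "\<pi> \<in> Sn n" for \<pi>
    using mesh12_occurrences_frame[of \<pi> n] that assms(2) by (simp add: R Sn_def)
  have card_Fix: "card ?Fix = fact (n - 2)"
    by (rule card_permutations) auto
  have card_Sn: "card (Sn n) = fact n"
    unfolding Sn_def by (rule card_permutations) auto
  have "{\<pi> \<in> Sn n. card (mesh12_occurrences R n \<pi>) = 1} = ?Fix"
    using sub occ by (auto split: if_splits)
  moreover have "{\<pi> \<in> Sn n. mesh12_avoids R n \<pi>} = Sn n - ?Fix"
    unfolding mesh12_avoids_def using occ by (auto split: if_splits)
  moreover have "finite ?Fix"
    by (rule finite_permutations) simp
  ultimately show ?thesis
    using card_Diff_subset[OF _ sub] card_Fix card_Sn by simp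
qed

end
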